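(* Let $(i_k)_{k\ge 0}$, $(q_k)_{k\ge 0}$, $(d_k)_{k\ge 0}$ be sequences of nonnegative integers, indexed by $k$ only. Let $(c_{n,k})_{n,k\ge 0}$ be the unique array determined by $$c_{n+1,k}=i_{k-1}\,c_{n,k-1}+q_k\,c_{n,k}+d_{k+1}\,c_{n,k+1}\qquad (n,k\ge 0),$$ $$c_{0,0}=1,\qquad c_{0,k}=0\ \text{ for } k>0,$$ where for $k=0$ the term $i_{-1}c_{n,-1}$ is taken to be $0$. Let $\{\Phi_n\}_{n\ge 0}$ be a sequence of polynomials in $x$ with real coefficients, with $\deg \Phi_n=n$ for every $n\ge 0$, satisfying $$x\,\Phi_n(x)=d_n\,\Phi_{n-1}(x)+q_n\,\Phi_n(x)+i_n\,\Phi_{n+1}(x)\qquad (n\ge 0),$$ $$\Phi_0(x)=1,\qquad \Phi_{-1}(x)=0.$$ Then for every $n\ge 0$, $$x^n=\sum_{k\ge 0} c_{n,k}\,\Phi_k(x).$$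
   Context: The numbers $i_k,q_k,d_k$ do not depend on the discrete time parameter $n$. In the combinatorial setting, $i_k$, $q_k$, $d_k$ are the numbers of possibilities to perform three respective operations ($I$, $Q$, $D$) on a file of size $k$, and $c_{n,k}$ is the number of ways to reach level $k$ in $n$ steps starting from level $0$. For each fixed $n$ only finitely many $c_{n,k}$ are nonzero, so the sum over $k$ is finite. *)

theory Defs
  imports Complex_Main "HOL-Computational_Algebra.Polynomial"
begin

end

theory Submission
  imports Defs
begin

text \<open>
  The two recurrences use the same tridiagonal matrix \<open>T\<close>, with entries \<open>T k (k + 1) = i k\<close>,
  \<open>T k k = q k\<close> and \<open>T k (k - 1) = d k\<close>: multiplying by the variable acts on the column of
  polynomials \<open>\<Phi>\<close> as \<open>x \<Phi> = T \<Phi>\<close>, whereas the row vector \<open>c n\<close> evolves by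
  \<open>c (n + 1) = c n T\<close>. Hence
  \[ x \cdot (c_n \Phi) = c_n (T \Phi) = (c_n T) \Phi = c_{n+1} \Phi, \]
  and since \<open>c 0\<close> is the first unit vector and \<open>\<Phi> 0 = 1\<close>, induction on \<open>n\<close> yields
  \<open>c n \<Phi> = x ^ n\<close>. The only step that needs an argument is the associativity in the middle; it is
  the re-indexing of finite sums in \<open>tridiagonal_assoc\<close>. The sums are finite because a step raises
  the level by at most one, so the \<open>n\<close>-th row lives on levels up to \<open>n\<close>
  (\<open>row_support\<close>).
\<close>

text \<open>
  Each step moves weight by at most one level, so weight starting at level \<open>0\<close> cannot pass
  level \<open>n\<close> in \<open>n\<close> steps.
\<close>

lemma row_support:
  fixes c :: "nat \<Rightarrow> nat \<Rightarrow> 'a :: comm_semiring_0"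
  assumes step: "\<And>n k. c (Suc n) k =
      (if k = 0 then 0 else i (k - 1) * c n (k - 1)) + q k * c n k + d (k + 1) * c n (k + 1)"
    and start: "\<And>k. k > 0 \<Longrightarrow> c 0 k = 0"
  shows "n < k \<Longrightarrow> c n k = 0"
proof (induction n arbitrary: k)
  case 0
  then show ?case by (simp add: start)
next
  case (Suc n)
  then show ?case by (simp add: step)
qed

text \<open>
  A transition from level \<open>k\<close> can be credited to its source or to its target. The left-hand side
  groups the transitions by source, the right-hand side by target; the up-steps are matched by
  shifting the index by one in one direction, the down-steps by shifting it in the other. The
  right-hand sum reaches one level higher because of the up-step from level \<open>n\<close>.
\<close>

lemma tridiagonal_assoc:
  fixes v i q d :: "nat \<Rightarrow> 'a :: comm_ring_1" and p :: "nat \<Rightarrow> 'a poly"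
  assumes support: "\<And>k. n < k \<Longrightarrow> v k = 0"
  shows "(\<Sum>k\<le>n. smult (v k)
        ((if k = 0 then 0 else smult (d k) (p (k - 1))) + smult (q k) (p k) + smult (i k) (p (k + 1))))
    = (\<Sum>k\<le>Suc n. smult
        ((if k = 0 then 0 else i (k - 1) * v (k - 1)) + q k * v k + d (k + 1) * v (k + 1)) (p k))"
proof -
  have up: "(\<Sum>k\<le>Suc n. smult (if k = 0 then 0 else i (k - 1) * v (k - 1)) (p k))
      = (\<Sum>k\<le>n. smult (v k * i k) (p (k + 1)))"
    by (subst sum.atMost_Suc_shift) (simp add: mult.commute)
  have stay: "(\<Sum>k\<le>Suc n. smult (q k * v k) (p k)) = (\<Sum>k\<le>n. smult (v k * q k) (p k))"
    by (simp add: support mult.commute)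
  \<comment> \<open>Extending the left-hand sum to \<open>Suc (Suc n)\<close> adds only zero terms and makes the ranges
    agree after the shift.\<close>
  have "(\<Sum>k\<le>n. smult (v k) (if k = 0 then 0 else smult (d k) (p (k - 1))))
      = (\<Sum>k\<le>Suc (Suc n). smult (v k) (if k = 0 then 0 else smult (d k) (p (k - 1))))"
    by (simp add: support)
  also have "\<dots> = (\<Sum>k\<le>Suc n. smult (d (k + 1) * v (k + 1)) (p k))"
    by (subst sum.atMost_Suc_shift) (simp add: mult.commute)
  finally have down: "(\<Sum>k\<le>n. smult (v k) (if k = 0 then 0 else smult (d k) (p (k - 1))))
      = (\<Sum>k\<le>Suc n. smult (d (k + 1) * v (k + 1)) (p k))" .
  show ?thesis
    unfolding smult_add_left smult_add_right smult_smult sum.distrib up stay down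
    by (simp only: ac_simps)
qed

theorem lemma1:
  fixes i q d :: "nat \<Rightarrow> nat"
    and c :: "nat \<Rightarrow> nat \<Rightarrow> nat"
    and \<Phi> :: "nat \<Rightarrow> real poly"
  assumes c_rec: "\<And>n k. c (n + 1) k =
      (if k = 0 then 0 else i (k - 1) * c n (k - 1)) + q k * c n k + d (k + 1) * c n (k + 1)"
    and c_0_0: "c 0 0 = 1"
    and c_0_pos: "\<And>k. k > 0 \<Longrightarrow> c 0 k = 0"
    and deg: "\<And>n. degree (\<Phi> n) = n"
    and \<Phi>_rec: "\<And>n. [:0, 1:] * \<Phi> n =
      (if n = 0 then 0 else smult (real (d n)) (\<Phi> (n - 1)))
        + smult (real (q n)) (\<Phi> n) + smult (real (i n)) (\<Phi> (n + 1))"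
    and \<Phi>_0: "\<Phi> 0 = 1"
  shows "\<forall>n. [:0, 1:] ^ n = (\<Sum>k | c n k \<noteq> 0. smult (real (c n k)) (\<Phi> k))"
proof
  fix n
  have step: "real (c (Suc n) k) = (if k = 0 then 0 else real (i (k - 1)) * real (c n (k - 1)))
      + real (q k) * real (c n k) + real (d (k + 1)) * real (c n (k + 1))" for n k
    using c_rec[of n k] by simp
  have support: "c n k = 0" if "n < k" for n k
    using row_support[of c i q d n k] c_rec c_0_pos that by simp
  have "[:0, 1:] ^ n = (\<Sum>k\<le>n. smult (real (c n k)) (\<Phi> k))"
  proof (induction n)
    case 0
    show ?case by (simp add: c_0_0 \<Phi>_0)
  next
    case (Suc n)
    have "[:0, 1:] ^ Suc n = (\<Sum>k\<le>n. smult (real (c n k)) ([:0, 1:] * \<Phi> k))"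
      by (simp only: power_Suc Suc.IH sum_distrib_left mult_smult_right)
    also have "\<dots> = (\<Sum>k\<le>Suc n. smult (real (c (Suc n) k)) (\<Phi> k))"
      unfolding \<Phi>_rec step by (rule tridiagonal_assoc) (simp add: support)
    finally show ?case .
  qed
  also have "\<dots> = (\<Sum>k | c n k \<noteq> 0. smult (real (c n k)) (\<Phi> k))"
    by (rule sum.mono_neutral_right) (use support in \<open>auto simp: not_less[symmetric]\<close>)
  finally show "[:0, 1:] ^ n = (\<Sum>k | c n k \<noteq> 0. smult (real (c n k)) (\<Phi> k))" .
qed

end
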